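(* Let $\Gamma$ be a connected faithful graph. Then $\mathrm{diam}(\Gamma)\le 2$.
   Context: All graphs are finite, simple and undirected with nonempty vertex set. $N_\Gamma[v]$ denotes the closed neighbourhood of a vertex $v$ ($v$ together with its neighbours). An edge $xy$ of $\Gamma$ is faithful if $N_\Gamma[x]\cup N_\Gamma[y] = V(\Gamma)$; $\Gamma$ is a faithful graph if every edge is faithful. The diameter of a connected graph is the maximum distance between two of its vertices. *)

theory Defs
  imports "Graph_Theory.Digraph_Component" "Graph_Theory.Shortest_Path"
begin

text \<open>
  Finite simple undirected graphs are the locale \<open>graph\<close> of \<open>Graph_Theory\<close>: finite symmetric
  digraphs without loops and parallel arcs, an undirected edge \<open>xy\<close> being the pair of arcs
  from \<open>x\<close> to \<open>y\<close> and from \<open>y\<close> to \<open>x\<close>.  That locale admits the graph without vertices, so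
  nonemptiness of the vertex set has to be assumed where it is wanted.
\<close>

definition closed_nbhd :: "('a, 'b) pre_digraph \<Rightarrow> 'a \<Rightarrow> 'a set" where
  "closed_nbhd G v = insert v {w. v \<rightarrow>\<^bsub>G\<^esub> w}"

definition faithful_edge :: "('a, 'b) pre_digraph \<Rightarrow> 'a \<Rightarrow> 'a \<Rightarrow> bool" where
  "faithful_edge G x y \<longleftrightarrow> x \<rightarrow>\<^bsub>G\<^esub> y \<and> closed_nbhd G x \<union> closed_nbhd G y = verts G"

definition faithful_graph :: "('a, 'b) pre_digraph \<Rightarrow> bool" where
  "faithful_graph G \<longleftrightarrow> (\<forall>x y. x \<rightarrow>\<^bsub>G\<^esub> y \<longrightarrow> faithful_edge G x y)"

text \<open>
  With unit arc costs, the cost of a walk is its number of arcs, so \<open>\<mu>\<close> is the usual distance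
  (\<open>\<infinity>\<close> between vertices that no walk joins).
\<close>

definition distance :: "('a, 'b) pre_digraph \<Rightarrow> 'a \<Rightarrow> 'a \<Rightarrow> ereal" where
  "distance G u v = wf_digraph.\<mu> G (\<lambda>_. 1) u v"

text \<open>The maximum below is meaningful only for a finite nonempty vertex set.\<close>

definition diameter :: "('a, 'b) pre_digraph \<Rightarrow> ereal" where
  "diameter G = Max {distance G u v | u v. u \<in> verts G \<and> v \<in> verts G}"

end

theory Submission
  imports Defs
begin

text \<open>Let u and v be distinct vertices. By connectedness u has a neighbour x, and the edge ux
  is faithful, so v lies in N[u] or in N[x]. Hence v is adjacent to u or to x, and a walk of length
  at most 2 joins u to v. \<open>faithful_distance_le_2\<close> is this argument;
  \<open>distance_le_length\<close> turns each exhibited walk into a bound on the distance.\<close>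

lemma (in wf_digraph) distance_le_length:
  assumes "awalk u p v"
  shows "distance G u v \<le> ereal (length p)"
proof -
  have "awalk_cost (\<lambda>_. 1) p = length p" for p :: "'b list"
    by (induct p) auto
  with min_cost_le_walk_cost[OF assms, of "\<lambda>_. 1"] show ?thesis
    by (simp add: distance_def)
qed

lemma (in wf_digraph) distance_le_2_if_common_neighbour:
  assumes "u \<rightarrow>\<^bsub>G\<^esub> x" "x \<rightarrow>\<^bsub>G\<^esub> v"
  shows "distance G u v \<le> 2"
proof -
  from assms obtain a b where "a \<in> arcs G" "b \<in> arcs G"
    "u = tail G a" "head G a = tail G b" "v = head G b"
    by (auto simp: arcs_ends_conv)
  then have "awalk u [a, b] v"
    by (simp add: awalk_simps)
  from distance_le_length[OF this] show ?thesis by simp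
qed

lemma (in wf_digraph) distance_le_1_if_adj:
  assumes "u \<rightarrow>\<^bsub>G\<^esub> v"
  shows "distance G u v \<le> 1"
proof -
  from assms obtain a where "a \<in> arcs G" "u = tail G a" "v = head G a"
    by (auto simp: arcs_ends_conv)
  then have "awalk u [a] v"
    by (simp add: awalk_simps)
  from distance_le_length[OF this] show ?thesis by (simp add: one_ereal_def)
qed

lemma (in wf_digraph) distance_self_le_0:
  assumes "u \<in> verts G"
  shows "distance G u u \<le> 0"
  using distance_le_length[of u "[]" u] assms by (simp add: awalk_simps zero_ereal_def)

text \<open>Reachability serves twice: it gives \<open>u\<close> an out-neighbour when
  \<open>u\<close> and \<open>v\<close> differ, and it places both in the vertex set.\<close>

lemma (in wf_digraph) faithful_distance_le_2:
  assumes "faithful_graph G" "u \<rightarrow>\<^sup>* v"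
  shows "distance G u v \<le> 2"
proof (cases "u = v")
  case True
  then show ?thesis
    using distance_self_le_0[of u] reachable_in_verts[OF assms(2)]
    by (auto intro: order_trans)
next
  case False
  \<comment> \<open>\<open>x\<close> is the second vertex of a walk from \<open>u\<close> to
    \<open>v\<close>, which has an arc since its ends differ.\<close>
  with assms(2) obtain x where ux: "u \<rightarrow>\<^bsub>G\<^esub> x"
    by (auto elim: converse_reachable_cases)
  then have "v \<in> closed_nbhd G u \<union> closed_nbhd G x"
    using assms reachable_in_verts[OF assms(2)]
    by (simp add: faithful_graph_def faithful_edge_def)
  \<comment> \<open>Membership in the neighbourhood of \<open>x\<close> includes
    \<open>v = x\<close>; then \<open>ux\<close> itself gives the first case.\<close>
  with False ux consider "u \<rightarrow>\<^bsub>G\<^esub> v" | "x \<rightarrow>\<^bsub>G\<^esub> v"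
    by (auto simp: closed_nbhd_def)
  then show ?thesis
  proof cases
    case 1
    then have "distance G u v \<le> 1" by (rule distance_le_1_if_adj)
    then show ?thesis by (rule order_trans) simp
  next
    case 2
    with ux show ?thesis by (rule distance_le_2_if_common_neighbour)
  qed
qed

theorem theorem3p6:
  fixes \<Gamma> :: "('a, 'b) pre_digraph"
  assumes "graph \<Gamma>"
    and "verts \<Gamma> \<noteq> {}"
    and "Digraph_Component.connected \<Gamma>"
    and "faithful_graph \<Gamma>"
  shows "diameter \<Gamma> \<le> 2"
proof -
  interpret graph \<Gamma> by fact
  let ?D = "{distance \<Gamma> u v | u v. u \<in> verts \<Gamma> \<and> v \<in> verts \<Gamma>}"
  \<comment> \<open>\<open>connected\<close> speaks of the symmetric closure; the arcs are already
    symmetric, so any two vertices are joined by a walk in the graph itself.\<close>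
  have "strongly_connected \<Gamma>"
    using assms(3) by (intro symmetric_connected_imp_strongly_connected sym_arcs)
  then have "d \<le> 2" if "d \<in> ?D" for d
    using that faithful_distance_le_2[OF assms(4)] by (auto simp: strongly_connected_def)
  \<comment> \<open>For a finite nonempty set, \<open>Max\<close> is at most 2 exactly when every
    element is.\<close>
  moreover have "finite ?D"
    by (rule finite_image_set2) auto
  moreover have "?D \<noteq> {}"
    using assms(2) by auto
  ultimately show ?thesis
    by (simp add: diameter_def)
qed

end
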